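(* Let $(X,p,E)$ be a lattice-normed Riesz space, let $Y$ be a sublattice (Riesz subspace) of $X$, and let $(y_n)$ be a sequence in $Y$ that is statistically unbounded $p$-convergent to $0$ in $Y$. Then $(y_n)$ is statistically unbounded $p$-convergent to $0$ in $X$ in each of the following cases: (i) $Y$ is majorizing in $X$; (ii) $Y$ is $p$-dense in $X$; (iii) $Y$ is a projection band in $X$.
   Context: All Riesz spaces (vector lattices) are real and Archimedean; sequences are indexed by the positive integers $\mathbb{N}$; $E_+$ and $X_+$ denote positive cones. A lattice-normed Riesz space $(X,p,E)$ consists of Riesz spaces $X$ and $E$ and a map $p:X\to E_+$ with $p(x)=0\Leftrightarrow x=0$, $p(\lambda x)=|\lambda|p(x)$ for $\lambda\in\mathbb{R}$, $p(x+y)\le p(x)+p(y)$, which is monotone: $|x|\le|y|$ implies $p(x)\le p(y)$. $Y$ is majorizing in $X$ if for every $u\in X_+$ there is $y\in Y$ with $u\le y$. $Y$ is $p$-dense in $X$ if for every $x\in X$ and every $0\ne w\in p(X)$ there is $y\in Y$ with $p(x-y)\le w$. The natural density of $K\subseteq\mathbb{N}$ is $\delta(K)=\lim_{n}\frac1n|\{k\le n:k\in K\}|$. A sequence $(q_n)$ in $E$ is statistically order decreasing to $0$, written $q_n\downarrow^{st}0$, if there is $K\subseteq\mathbb{N}$ with $\delta(K)=1$ such that $(q_k)_{k\in K}$ is decreasing and $\inf_{k\in K}q_k=0$. A sequence $(x_n)$ in $X$ is statistically unbounded $p$-convergent ($st$-$up$-convergent) to $x\in X$ (in $X$) if for every $u\in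 X_+$ there exist a sequence $q_n\downarrow^{st}0$ in $E$ and a set $K\subseteq\mathbb{N}$ with $\delta(K)=1$ such that $p(|x_k-x|\wedge u)\le q_k$ for all $k\in K$. Convergence in $Y$ means convergence in the lattice-normed Riesz space $(Y,p|_Y,E)$, i.e. the same condition with $u$ ranging only over $Y_+$. *)

theory Defs
  imports "HOL-Analysis.Analysis" "HOL-Library.Lattice_Algebras" "HOL-Library.Lub_Glb"
begin

class archimedean_riesz_space = ordered_real_vector + lattice_ab_group_add_abs +
  assumes archimedean: "0 \<le> x \<Longrightarrow> 0 \<le> y \<Longrightarrow> (\<And>n::nat. real n *\<^sub>R x \<le> y) \<Longrightarrow> x = 0"

locale lattice_normed_riesz_space =
  fixes p :: "'x::archimedean_riesz_space \<Rightarrow> 'e::archimedean_riesz_space"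
  assumes nonneg: "0 \<le> p x"
    and eq_zero_iff: "p x = 0 \<longleftrightarrow> x = 0"
    and homogeneous: "p (r *\<^sub>R x) = \<bar>r\<bar> *\<^sub>R p x"
    and triangle: "p (x + y) \<le> p x + p y"
    and monotone: "\<bar>x\<bar> \<le> \<bar>y\<bar> \<Longrightarrow> p x \<le> p y"

definition riesz_subspace :: "'x::archimedean_riesz_space set \<Rightarrow> bool" where
  "riesz_subspace Y \<longleftrightarrow> subspace Y \<and> (\<forall>x\<in>Y. \<forall>y\<in>Y. sup x y \<in> Y \<and> inf x y \<in> Y)"

definition majorizing :: "'x::archimedean_riesz_space set \<Rightarrow> bool" where
  "majorizing Y \<longleftrightarrow> (\<forall>u\<ge>0. \<exists>y\<in>Y. u \<le> y)"

definition p_dense ::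
  "('x::archimedean_riesz_space \<Rightarrow> 'e::archimedean_riesz_space) \<Rightarrow> 'x set \<Rightarrow> bool" where
  "p_dense p Y \<longleftrightarrow> (\<forall>x. \<forall>w\<in>range p. w \<noteq> 0 \<longrightarrow> (\<exists>y\<in>Y. p (x - y) \<le> w))"

definition order_ideal :: "'x::archimedean_riesz_space set \<Rightarrow> bool" where
  "order_ideal B \<longleftrightarrow> subspace B \<and> (\<forall>x y. y \<in> B \<longrightarrow> \<bar>x\<bar> \<le> \<bar>y\<bar> \<longrightarrow> x \<in> B)"

definition band :: "'x::archimedean_riesz_space set \<Rightarrow> bool" where
  "band B \<longleftrightarrow> order_ideal B \<and> (\<forall>A x. A \<subseteq> B \<longrightarrow> A \<noteq> {} \<longrightarrow> isLub UNIV A x \<longrightarrow> x \<in> B)"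

definition disjoint_complement :: "'x::archimedean_riesz_space set \<Rightarrow> 'x set" where
  "disjoint_complement B = {x. \<forall>y\<in>B. inf \<bar>x\<bar> \<bar>y\<bar> = 0}"

text \<open>The sum of \<^term>\<open>B\<close> and its disjoint complement is automatically direct.\<close>
definition projection_band :: "'x::archimedean_riesz_space set \<Rightarrow> bool" where
  "projection_band B \<longleftrightarrow> band B \<and> (\<forall>x. \<exists>b\<in>B. \<exists>c\<in>disjoint_complement B. x = b + c)"

text \<open>Sequences are indexed by the positive integers: they are functions on \<^typ>\<open>nat\<close>
  whose value at \<open>0\<close> is irrelevant, and index sets are subsets of \<open>{1..}\<close>.\<close>

definition has_natural_density :: "nat set \<Rightarrow> real \<Rightarrow> bool" where
  "has_natural_density K d \<longleftrightarrow>
     (\<lambda>n. real (card {k \<in> K. 1 \<le> k \<and> k \<le> n}) / real n) \<longlonglongrightarrow> d"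

definition st_decreasing_to_0 :: "(nat \<Rightarrow> 'e::archimedean_riesz_space) \<Rightarrow> bool" where
  "st_decreasing_to_0 q \<longleftrightarrow>
     (\<exists>K\<subseteq>{1..}. has_natural_density K 1 \<and>
        monotone_on K (\<le>) (\<ge>) q \<and> isGlb UNIV (q ` K) 0)"

text \<open>Convergence in the lattice-normed space \<open>(Z, p|Z, E)\<close> for a Riesz subspace \<open>Z\<close>,
  for a sequence and a limit lying in \<open>Z\<close>; \<open>Z = UNIV\<close> is convergence in \<open>X\<close>.\<close>
definition st_up_convergent_in ::
  "('x::archimedean_riesz_space \<Rightarrow> 'e::archimedean_riesz_space) \<Rightarrow> 'x set \<Rightarrow>
     (nat \<Rightarrow> 'x) \<Rightarrow> 'x \<Rightarrow> bool" where
  "st_up_convergent_in p Z x l \<longleftrightarrow>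
     (\<forall>u\<in>Z. 0 \<le> u \<longrightarrow>
        (\<exists>q K. st_decreasing_to_0 q \<and> K \<subseteq> {1..} \<and> has_natural_density K 1 \<and>
           (\<forall>k\<in>K. p (inf \<bar>x k - l\<bar> u) \<le> q k)))"

end

(* Only the p-dense case is not immediate. For 0 \<le> u pick v\<^sub>n in Y with
   p (u - v\<^sub>n) \<le> p u / (n+1). Then p (|y\<^sub>k| \<and> u) \<le> p (|y\<^sub>k| \<and> |v\<^sub>n|) + p u / (n+1), so there are
   countably many dominating sequences, each decreasing on its own set of density one. Sets of
   density one have a pseudo-intersection of density one, and the infima of finitely many (but
   more and more) of the bounds form a single dominating sequence there; its infimum is 0
   because E is Archimedean. *)
theory Submission
  imports Defs
begin

section \<open>Sets of natural density one\<close>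

text \<open>The counting quotient never exceeds 1, so only its lower bounds matter. The
  division-free form is linear in the counts, which suits inclusion-exclusion, and is harmless at
  \<open>n = 0\<close>.\<close>

lemma has_natural_density_1_iff:
  "has_natural_density K 1 \<longleftrightarrow>
     (\<forall>e>0. \<forall>\<^sub>F n in sequentially. (1 - e) * real n \<le> real (card {k \<in> K. 1 \<le> k \<and> k \<le> n}))"
proof -
  let ?c = "\<lambda>n. real (card {k \<in> K. 1 \<le> k \<and> k \<le> n})"
  have le: "?c n \<le> real n" for n
  proof -
    have "card {k \<in> K. 1 \<le> k \<and> k \<le> n} \<le> card {1..n}"
      by (rule card_mono) auto
    then show ?thesis by simp
  qed
  show ?thesis
  proof
    assume K: "has_natural_density K 1"
    show "\<forall>e>0. \<forall>\<^sub>F n in sequentially. (1 - e) * real n \<le> ?c n"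
    proof (intro allI impI)
      fix e :: real
      assume "e > 0"
      then have "\<forall>\<^sub>F n in sequentially. 1 - e < ?c n / real n"
        using K unfolding has_natural_density_def by (intro order_tendstoD(1)) auto
      with eventually_gt_at_top[of 0] show "\<forall>\<^sub>F n in sequentially. (1 - e) * real n \<le> ?c n"
        by eventually_elim (simp add: pos_less_divide_eq less_imp_le)
    qed
  next
    assume *: "\<forall>e>0. \<forall>\<^sub>F n in sequentially. (1 - e) * real n \<le> ?c n"
    show "has_natural_density K 1"
      unfolding has_natural_density_def
    proof (rule order_tendstoI)
      fix a :: real
      assume "a < 1"
      then have "\<forall>\<^sub>F n in sequentially. (1 - (1 - a) / 2) * real n \<le> ?c n"
        using * by simp
      with eventually_gt_at_top[of 0] show "\<forall>\<^sub>F n in sequentially. a < ?c n / real n"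
      proof eventually_elim
        case (elim n)
        have "a * real n < (1 - (1 - a) / 2) * real n"
          using \<open>a < 1\<close> elim(1) by (intro mult_strict_right_mono) (auto simp: field_simps)
        also note elim(2)
        finally show ?case using elim(1) by (simp add: pos_less_divide_eq)
      qed
    next
      fix a :: real
      assume "1 < a"
      have "?c n / real n \<le> 1" for n
        using le[of n] by (cases "n = 0") (simp_all add: divide_le_eq_1)
      then show "\<forall>\<^sub>F n in sequentially. ?c n / real n < a"
        using \<open>1 < a\<close> by (intro always_eventually) (meson le_less_trans)
    qed
  qed
qed

lemma has_natural_density_1_atLeast: "has_natural_density {m..} 1"
  unfolding has_natural_density_1_iff eventually_sequentially
proof (intro allI impI exI)
  fix e :: real and n :: nat
  assume e: "e > 0" and n: "nat \<lceil>real m / e\<rceil> \<le> n"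
  then have "real m / e \<le> real n" by linarith
  with e have me: "real m \<le> e * real n"
    by (simp add: pos_divide_le_eq mult.commute)
  \<comment> \<open>The interval is open at \<open>m\<close> so that it holds positive indices only,
    even for \<open>m = 0\<close>; its cardinality is the truncated difference
    \<open>n - m\<close>.\<close>
  have "card {m<..n} \<le> card {k \<in> {m..}. 1 \<le> k \<and> k \<le> n}"
  proof (rule card_mono)
    show "finite {k \<in> {m..}. 1 \<le> k \<and> k \<le> n}"
      by (rule finite_subset[of _ "{..n}"]) auto
    show "{m<..n} \<subseteq> {k \<in> {m..}. 1 \<le> k \<and> k \<le> n}"
      by (intro subsetI) simp
  qed
  then have "real n - real m \<le> real (card {k \<in> {m..}. 1 \<le> k \<and> k \<le> n})"
    by simp
  with me show "(1 - e) * real n \<le> real (card {k \<in> {m..}. 1 \<le> k \<and> k \<le> n})"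
    by (simp add: left_diff_distrib)
qed

text \<open>Inclusion-exclusion: the union has at most \<open>n\<close> elements up to
  \<open>n\<close>, so the losses of the two sets, \<open>e/2\<close> each, add up to at most
  \<open>e\<close>.\<close>

lemma has_natural_density_1_Int:
  assumes "has_natural_density K 1" "has_natural_density L 1"
  shows "has_natural_density (K \<inter> L) 1"
  unfolding has_natural_density_1_iff
proof (intro allI impI)
  fix e :: real
  assume "e > 0"
  then have "\<forall>\<^sub>F n in sequentially. (1 - e/2) * real n \<le> real (card {k \<in> K. 1 \<le> k \<and> k \<le> n})"
    and "\<forall>\<^sub>F n in sequentially. (1 - e/2) * real n \<le> real (card {k \<in> L. 1 \<le> k \<and> k \<le> n})"
    using assms unfolding has_natural_density_1_iff by simp_all
  then show "\<forall>\<^sub>F n in sequentially.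
      (1 - e) * real n \<le> real (card {k \<in> K \<inter> L. 1 \<le> k \<and> k \<le> n})"
  proof eventually_elim
    case (elim n)
    let ?K = "{k \<in> K. 1 \<le> k \<and> k \<le> n}" and ?L = "{k \<in> L. 1 \<le> k \<and> k \<le> n}"
    have fin: "finite ?K" "finite ?L" by simp_all
    have "card (?K \<union> ?L) \<le> card {1..n}"
      by (rule card_mono) auto
    moreover have "?K \<inter> ?L = {k \<in> K \<inter> L. 1 \<le> k \<and> k \<le> n}" by auto
    ultimately have "card ?K + card ?L \<le> n + card {k \<in> K \<inter> L. 1 \<le> k \<and> k \<le> n}"
      using card_Un_Int[OF fin] by simp
    then have "real (card ?K) + real (card ?L)
        \<le> real n + real (card {k \<in> K \<inter> L. 1 \<le> k \<and> k \<le> n})"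
      by linarith
    with elim show ?case by (simp add: algebra_simps)
  qed
qed

text \<open>For large \<open>n > 2 * m\<close>, at least half of the indices up to \<open>n\<close>
  lie in \<open>K\<close>; these are more than \<open>m\<close>, so they do not all fit into
  \<open>{1..m}\<close>.\<close>

lemma has_natural_density_1_unbounded:
  assumes "has_natural_density K 1"
  obtains k where "k \<in> K" "m \<le> k"
proof -
  have "\<forall>\<^sub>F n in sequentially.
      (1 - 1/2) * real n \<le> real (card {k \<in> K. 1 \<le> k \<and> k \<le> n})"
    using assms unfolding has_natural_density_1_iff by (auto dest: spec[of _ "1/2"])
  then have "\<forall>\<^sub>F n in sequentially.
      2 * m < n \<and> (1 - 1/2) * real n \<le> real (card {k \<in> K. 1 \<le> k \<and> k \<le> n})"
    using eventually_gt_at_top[of "2*m"] by eventually_elim simp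
  then obtain n where n: "2 * m < n"
      "(1 - 1/2) * real n \<le> real (card {k \<in> K. 1 \<le> k \<and> k \<le> n})"
    using eventually_happens sequentially_bot by blast
  have "\<not> {k \<in> K. 1 \<le> k \<and> k \<le> n} \<subseteq> {1..m}"
  proof
    assume "{k \<in> K. 1 \<le> k \<and> k \<le> n} \<subseteq> {1..m}"
    then have "card {k \<in> K. 1 \<le> k \<and> k \<le> n} \<le> card {1..m}"
      by (intro card_mono) auto
    with n show False by simp
  qed
  then show thesis using that by fastforce
qed

section \<open>Pseudo-intersections of countably many sets of density one\<close>

lemma strict_mono_finite_le:
  fixes N :: "nat \<Rightarrow> nat"
  assumes "strict_mono N"
  shows "finite {n. N n \<le> m}"
proof (rule finite_subset)
  show "{n. N n \<le> m} \<subseteq> {..m}"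
  proof
    fix n
    assume "n \<in> {n. N n \<le> m}"
    then show "n \<in> {..m}"
      using strict_mono_imp_increasing[OF assms, of n] by simp
  qed
qed simp

text \<open>Diagonal construction: the condition \<open>k \<in> K n\<close> is imposed only from
  \<open>N n\<close> on, and \<open>N n\<close> is chosen so late that \<open>K 0\<close>, ...,
  \<open>K n\<close> together already lose at most the fraction \<open>1 / real (Suc n)\<close> of
  the indices.\<close>

lemma has_natural_density_1_pseudo_intersection:
  fixes K :: "nat \<Rightarrow> nat set"
  assumes K: "\<And>n. has_natural_density (K n) 1"
  obtains L N where "L \<subseteq> {1..}" "has_natural_density L 1" "strict_mono N" "N 0 = 0"
    "\<forall>n. \<forall>k\<in>L. N n \<le> k \<longrightarrow> k \<in> K n"
proof -
  define J where "J n = (\<Inter>i\<le>n. K i)" for n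
  have J: "has_natural_density (J n) 1" for n
  proof (induction n)
    case 0
    then show ?case using K by (simp add: J_def)
  next
    case (Suc n)
    have "J (Suc n) = K (Suc n) \<inter> J n"
      by (simp add: J_def atMost_Suc)
    with Suc K show ?case by (simp add: has_natural_density_1_Int)
  qed
  \<comment> \<open>For \<open>n = 0\<close> the factor \<open>1 - 1 / real (Suc n)\<close>
    vanishes, so the threshold 0 works. This yields \<open>N 0 = 0\<close>, hence at every index at
    least one condition is in force.\<close>
  have "\<forall>n. \<exists>M. (n = 0 \<longrightarrow> M = 0) \<and>
      (\<forall>m\<ge>M. (1 - 1 / real (Suc n)) * real m \<le> real (card {k \<in> J n. 1 \<le> k \<and> k \<le> m}))"
  proof
    fix n
    show "\<exists>M. (n = 0 \<longrightarrow> M = 0) \<and>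
        (\<forall>m\<ge>M. (1 - 1 / real (Suc n)) * real m \<le> real (card {k \<in> J n. 1 \<le> k \<and> k \<le> m}))"
    proof (cases "n = 0")
      case False
      have "\<forall>\<^sub>F m in sequentially.
          (1 - 1 / real (Suc n)) * real m \<le> real (card {k \<in> J n. 1 \<le> k \<and> k \<le> m})"
        using J[of n, unfolded has_natural_density_1_iff, rule_format, of "1 / real (Suc n)"]
        by simp
      then show ?thesis
        unfolding eventually_sequentially using False by blast
    qed auto
  qed
  from choice[OF this] obtain M where M_spec: "\<forall>n. (n = 0 \<longrightarrow> M n = 0) \<and>
      (\<forall>m\<ge>M n. (1 - 1 / real (Suc n)) * real m \<le> real (card {k \<in> J n. 1 \<le> k \<and> k \<le> m}))" ..
  then have M0: "M 0 = 0" by simp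
  have M: "(1 - 1 / real (Suc n)) * real m \<le> real (card {k \<in> J n. 1 \<le> k \<and> k \<le> m})"
    if "M n \<le> m" for n m
    using M_spec that by blast
  \<comment> \<open>The summand \<open>n\<close> makes \<open>N\<close> strictly increasing; the sum
    keeps \<open>N n\<close> above the threshold \<open>M n\<close>.\<close>
  define N where "N n = n + (\<Sum>i\<le>n. M i)" for n
  have N: "strict_mono N"
    by (simp add: strict_mono_Suc_iff N_def)
  have MN: "M n \<le> N n" for n
    unfolding N_def by (intro trans_le_add2 member_le_sum) auto
  define L where "L = {k. 1 \<le> k \<and> (\<forall>n. N n \<le> k \<longrightarrow> k \<in> K n)}"
  have "has_natural_density L 1"
    unfolding has_natural_density_1_iff
  proof (intro allI impI)
    fix e :: real
    assume "e > 0"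
    then obtain n0 where n0: "1 / real (Suc n0) < e"
      using nat_approx_posE by blast
    have "(1 - e) * real m \<le> real (card {k \<in> L. 1 \<le> k \<and> k \<le> m})" if m: "N n0 \<le> m" for m
    proof -
      have fin: "finite {n. N n \<le> m}"
        using N by (rule strict_mono_finite_le)
      \<comment> \<open>This is the last condition in force up to \<open>m\<close>. Positive
        elements of \<open>J n\<close> up to \<open>m\<close> satisfy every condition that applies
        to them, so they lie in \<open>L\<close>, which inherits the density estimate for
        \<open>J n\<close>.\<close>
      define n where "n = Max {n. N n \<le> m}"
      have n: "N n \<le> m"
        using Max_in[OF fin] m by (auto simp: n_def)
      have max: "i \<le> n" if "N i \<le> m" for i
        using Max_ge[OF fin] that by (simp add: n_def)
      have "1 / real (Suc n) \<le> 1 / real (Suc n0)"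
        using max[OF m] by (simp add: field_simps)
      with n0 have "(1 - e) * real m \<le> (1 - 1 / real (Suc n)) * real m"
        by (intro mult_right_mono) auto
      also have "\<dots> \<le> real (card {k \<in> J n. 1 \<le> k \<and> k \<le> m})"
        using MN n by (intro M) (rule order_trans)
      also have "\<dots> \<le> real (card {k \<in> L. 1 \<le> k \<and> k \<le> m})"
        unfolding of_nat_le_iff
      proof (rule card_mono)
        show "{k \<in> J n. 1 \<le> k \<and> k \<le> m} \<subseteq> {k \<in> L. 1 \<le> k \<and> k \<le> m}"
          using max by (auto simp: J_def L_def dest: order_trans)
      qed simp
      finally show ?thesis .
    qed
    then show "\<forall>\<^sub>F m in sequentially. (1 - e) * real m \<le> real (card {k \<in> L. 1 \<le> k \<and> k \<le> m})"
      unfolding eventually_sequentially by blast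
  qed
  then show thesis
    using N M0 by (intro that[of L N]) (auto simp: L_def N_def)
qed

section \<open>Statistically order null sequences\<close>

lemma isGlb_image_0_iff:
  "isGlb UNIV (q ` K) (0::'e::archimedean_riesz_space) \<longleftrightarrow>
     (\<forall>k\<in>K. 0 \<le> q k) \<and> (\<forall>z. (\<forall>k\<in>K. z \<le> q k) \<longrightarrow> z \<le> 0)"
  by (auto simp: isGlb_def greatestP_def isLb_def setge_def setle_def)

text \<open>The Archimedean axiom concerns nonnegative elements, so it is applied to the positive
  part \<open>sup z 0\<close>, all of whose natural multiples stay below \<open>w\<close>.\<close>

lemma archimedean_le_0:
  fixes w z :: "'e::archimedean_riesz_space"
  assumes "0 \<le> w" "\<And>n. z \<le> (1 / real (Suc n)) *\<^sub>R w"
  shows "z \<le> 0"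
proof -
  have "real n *\<^sub>R sup z 0 \<le> w" for n
  proof (cases n)
    case (Suc m)
    have "sup z 0 \<le> (1 / real (Suc m)) *\<^sub>R w"
      using assms by (simp add: scaleR_nonneg_nonneg)
    then have "real (Suc m) *\<^sub>R sup z 0 \<le> real (Suc m) *\<^sub>R (1 / real (Suc m)) *\<^sub>R w"
      by (rule scaleR_left_mono) simp
    also have "\<dots> = w"
      by simp
    finally show ?thesis using Suc by simp
  qed (use assms in simp)
  then have "sup z 0 = 0"
    using assms(1) by (intro archimedean[of _ w]) auto
  then show ?thesis
    by (simp add: sup.absorb_iff2)
qed

text \<open>The condition inside \<open>st_up_convergent_in\<close> for one test element, isolated
  as a property of a sequence in the norming space, so that domination arguments take place
  there.\<close>

definition st_order_null :: "(nat \<Rightarrow> 'e::archimedean_riesz_space) \<Rightarrow> bool" where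
  "st_order_null r \<longleftrightarrow>
     (\<exists>q K. st_decreasing_to_0 q \<and> K \<subseteq> {1..} \<and> has_natural_density K 1 \<and> (\<forall>k\<in>K. r k \<le> q k))"

lemma st_up_convergent_in_0_iff:
  "st_up_convergent_in p Z x 0 \<longleftrightarrow> (\<forall>u\<in>Z. 0 \<le> u \<longrightarrow> st_order_null (\<lambda>k. p (inf \<bar>x k\<bar> u)))"
  by (simp add: st_up_convergent_in_def st_order_null_def)

lemma st_order_null_mono:
  assumes "st_order_null r" "\<And>k. 1 \<le> k \<Longrightarrow> s k \<le> r k"
  shows "st_order_null s"
proof -
  obtain q K where qK: "st_decreasing_to_0 q" "K \<subseteq> {1..}" "has_natural_density K 1"
      "\<forall>k\<in>K. r k \<le> q k"
    using assms(1) unfolding st_order_null_def by blast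
  have "\<forall>k\<in>K. s k \<le> q k"
  proof
    fix k
    assume "k \<in> K"
    then show "s k \<le> q k"
      using qK(2,4) by (intro order_trans[OF assms(2)]) auto
  qed
  with qK show ?thesis
    unfolding st_order_null_def by blast
qed

text \<open>The two sets of density one merge into \<open>K\<close>. The infimum property is stated
  for all subsets \<open>L\<close> of density one, so that it survives later shrinking:
  \<open>L\<close> is unbounded and \<open>q\<close> decreases, so a lower bound along
  \<open>L\<close> bounds all earlier terms too.\<close>

lemma st_order_nullE:
  assumes "st_order_null r"
  obtains q K where "has_natural_density K 1" "monotone_on K (\<le>) (\<ge>) q"
    "\<forall>z L. has_natural_density L 1 \<longrightarrow> L \<subseteq> K \<longrightarrow> (\<forall>k\<in>L. z \<le> q k) \<longrightarrow> z \<le> 0"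
    "\<forall>k\<in>K. r k \<le> q k"
proof -
  obtain q K0 K1 where K0: "has_natural_density K0 1" "\<forall>k\<in>K0. r k \<le> q k"
    and K1: "has_natural_density K1 1" "monotone_on K1 (\<le>) (\<ge>) q" "isGlb UNIV (q ` K1) 0"
    using assms unfolding st_order_null_def st_decreasing_to_0_def by blast
  have "z \<le> 0" if L: "has_natural_density L 1" "L \<subseteq> K0 \<inter> K1" "\<forall>k\<in>L. z \<le> q k" for z L
  proof -
    have "z \<le> q k" if "k \<in> K1" for k
    proof -
      obtain l where "l \<in> L" "k \<le> l"
        using has_natural_density_1_unbounded[OF L(1)] .
      then have "z \<le> q l" "q l \<le> q k"
        using L that K1(2) by (auto dest: monotone_onD)
      then show ?thesis by simp
    qed
    then show ?thesis
      using K1(3) by (simp add: isGlb_image_0_iff)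
  qed
  moreover have "monotone_on (K0 \<inter> K1) (\<le>) (\<ge>) q"
    using K1(2) by (rule monotone_on_subset) simp
  moreover have "has_natural_density (K0 \<inter> K1) 1"
    using K0(1) K1(1) by (rule has_natural_density_1_Int)
  ultimately show thesis
    using K0(2) by (intro that[of "K0 \<inter> K1" q]) blast+
qed

text \<open>The diagonal argument: countably many bounds, each valid on its own set of density one
  and up to an error tending to 0, are merged into one decreasing bound.\<close>

lemma st_order_null_approx:
  fixes s :: "nat \<Rightarrow> 'e::archimedean_riesz_space"
  assumes r: "\<And>n. st_order_null (r n)"
    and s: "\<And>n k. 1 \<le> k \<Longrightarrow> s k \<le> r n k + (1 / real (Suc n)) *\<^sub>R w"
    and s_nonneg: "\<And>k. 0 \<le> s k" and w: "0 \<le> w"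
  shows "st_order_null s"
proof -
  have "\<forall>n. \<exists>K. \<exists>q. has_natural_density K 1 \<and> monotone_on K (\<le>) (\<ge>) q \<and>
      (\<forall>z L. has_natural_density L 1 \<longrightarrow> L \<subseteq> K \<longrightarrow> (\<forall>k\<in>L. z \<le> q k) \<longrightarrow> z \<le> 0) \<and>
      (\<forall>k\<in>K. r n k \<le> q k)"
    using st_order_nullE[OF r] by metis
  from choice[OF this] obtain K where "\<forall>n. \<exists>q. has_natural_density (K n) 1 \<and>
      monotone_on (K n) (\<le>) (\<ge>) q \<and>
      (\<forall>z L. has_natural_density L 1 \<longrightarrow> L \<subseteq> K n \<longrightarrow> (\<forall>k\<in>L. z \<le> q k) \<longrightarrow> z \<le> 0) \<and>
      (\<forall>k\<in>K n. r n k \<le> q k)" ..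
  from choice[OF this] obtain q where qK: "\<forall>n. has_natural_density (K n) 1 \<and>
      monotone_on (K n) (\<le>) (\<ge>) (q n) \<and>
      (\<forall>z L. has_natural_density L 1 \<longrightarrow> L \<subseteq> K n \<longrightarrow> (\<forall>k\<in>L. z \<le> q n k) \<longrightarrow> z \<le> 0) \<and>
      (\<forall>k\<in>K n. r n k \<le> q n k)" ..
  have K: "has_natural_density (K n) 1" and q_dec: "monotone_on (K n) (\<le>) (\<ge>) (q n)" for n
    using qK by blast+
  have q_Glb: "z \<le> 0"
    if "has_natural_density L 1" "L \<subseteq> K n" "\<forall>k\<in>L. z \<le> q n k" for n z L
    using qK that by blast
  have q: "r n k \<le> q n k" if "k \<in> K n" for n k
    using qK that by blast
  obtain L N where L: "L \<subseteq> {1..}" "has_natural_density L 1"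
    and N: "strict_mono N" "N 0 = 0" and LK': "\<forall>n. \<forall>k\<in>L. N n \<le> k \<longrightarrow> k \<in> K n"
    using has_natural_density_1_pseudo_intersection[of K, OF K] .
  have LK: "k \<in> K n" if "k \<in> L" "N n \<le> k" for n k
    using LK' that by blast
  define b where "b n k = q n k + (1 / real (Suc n)) *\<^sub>R w" for n k
  \<comment> \<open>Only finite infima are available in a lattice. The index set is finite since
    \<open>N\<close> is strictly increasing, nonempty since \<open>N 0 = 0\<close>, and grows with
    \<open>k\<close>.\<close>
  define Q where "Q k = Inf_fin ((\<lambda>n. b n k) ` {n. N n \<le> k})" for k
  have fin: "finite {n. N n \<le> k}" for k
    using N(1) by (rule strict_mono_finite_le)
  have ne: "{n. N n \<le> k} \<noteq> {}" for k
    using N(2) by (auto intro: exI[of _ 0])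
  have Q_le: "Q k \<le> b n k" if "N n \<le> k" for n k
    unfolding Q_def using that fin by (intro Inf_fin.coboundedI) auto
  have le_Q: "a \<le> Q k" if "\<And>n. N n \<le> k \<Longrightarrow> a \<le> b n k" for a k
    unfolding Q_def using that fin ne by (intro Inf_fin.boundedI) auto
  have s_Q: "s k \<le> Q k" if "k \<in> L" for k
  proof (rule le_Q)
    fix n
    assume "N n \<le> k"
    then have "r n k + (1 / real (Suc n)) *\<^sub>R w \<le> b n k"
      unfolding b_def using that by (intro add_right_mono q LK)
    moreover have "s k \<le> r n k + (1 / real (Suc n)) *\<^sub>R w"
      using s L(1) that by auto
    ultimately show "s k \<le> b n k" by (rule order_trans[rotated])
  qed
  have "monotone_on L (\<le>) (\<ge>) Q"
  proof (rule monotone_onI)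
    fix k l
    assume kl: "k \<in> L" "l \<in> L" "k \<le> l"
    show "Q l \<le> Q k"
    \<comment> \<open>Every bound entering \<open>Q k\<close> also enters \<open>Q l\<close>, and it
      has decreased from \<open>k\<close> to \<open>l\<close>, because both indices lie in
      \<open>K n\<close>.\<close>
    proof (rule le_Q)
      fix n
      assume n: "N n \<le> k"
      then have "Q l \<le> b n l"
        using kl by (intro Q_le) simp
      also have "\<dots> \<le> b n k"
        unfolding b_def using kl n LK by (intro add_right_mono monotone_onD[OF q_dec]) auto
      finally show "Q l \<le> b n k" .
    qed
  qed
  moreover have "isGlb UNIV (Q ` L) 0"
    unfolding isGlb_image_0_iff
  proof (intro conjI allI impI ballI)
    show "0 \<le> Q k" if "k \<in> L" for k
      using s_nonneg s_Q[OF that] by (rule order_trans)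
    fix z
    assume z: "\<forall>k\<in>L. z \<le> Q k"
    show "z \<le> 0"
    proof (rule archimedean_le_0[OF w])
      fix n
      \<comment> \<open>From \<open>N n\<close> on, \<open>b n\<close> is among the bounds defining
        \<open>Q\<close>. This tail of \<open>L\<close> still has density one, so the infimum
        property of \<open>q n\<close> applies to \<open>z\<close> minus the error term.\<close>
      have "has_natural_density (L \<inter> {N n..}) 1"
        by (rule has_natural_density_1_Int[OF L(2) has_natural_density_1_atLeast])
      moreover have "z - (1 / real (Suc n)) *\<^sub>R w \<le> q n k" if "k \<in> L \<inter> {N n..}" for k
        using that z Q_le[of n k] by (auto simp: b_def diff_le_eq intro: order_trans)
      ultimately have "z - (1 / real (Suc n)) *\<^sub>R w \<le> 0"
        using LK by (intro q_Glb[of "L \<inter> {N n..}" n]) auto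
      then show "z \<le> (1 / real (Suc n)) *\<^sub>R w" by simp
    qed
  qed
  ultimately have "st_decreasing_to_0 Q"
    using L unfolding st_decreasing_to_0_def by blast
  then show ?thesis
    using L s_Q unfolding st_order_null_def by blast
qed

section \<open>Passing from a sublattice to the whole space\<close>

text \<open>Addition distributes over \<open>inf\<close>, so the right-hand side is the infimum of
  the four sums \<open>a + a\<close>, \<open>a + c\<close>, \<open>b + a\<close>,
  \<open>b + c\<close>, each of which dominates the left-hand side.\<close>

lemma inf_add_le:
  fixes a b c :: "'x::archimedean_riesz_space"
  assumes "0 \<le> a" "0 \<le> b" "0 \<le> c"
  shows "inf a (b + c) \<le> inf a b + inf a c"
proof -
  have "inf a (b + c) \<le> a + a" "inf a (b + c) \<le> a + c"
      "inf a (b + c) \<le> b + a" "inf a (b + c) \<le> b + c"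
    using assms by (auto intro: le_infI1 add_increasing add_increasing2)
  then show ?thesis
    by (simp add: add_inf_distrib_left add_inf_distrib_right)
qed

lemma riesz_subspace_abs:
  assumes "riesz_subspace Y" "v \<in> Y"
  shows "\<bar>v\<bar> \<in> Y"
  using assms by (simp add: riesz_subspace_def abs_lattice subspace_neg)

context lattice_normed_riesz_space
begin

lemma monotone_nonneg: "0 \<le> a \<Longrightarrow> a \<le> b \<Longrightarrow> p a \<le> p b"
  by (rule monotone) simp

lemma abs_eq: "p \<bar>a\<bar> = p a"
  by (rule order_antisym; rule monotone) simp_all

section \<open>The majorizing, p-dense and projection band cases\<close>

context
  fixes Y :: "'x set" and y :: "nat \<Rightarrow> 'x"
  assumes Y: "riesz_subspace Y"
    and y_null: "st_up_convergent_in p Y y 0"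
begin

text \<open>Taking absolute values makes every element of \<open>Y\<close>, whatever its sign,
  usable as a test element.\<close>

lemma st_order_null_abs:
  "v \<in> Y \<Longrightarrow> st_order_null (\<lambda>k. p (inf \<bar>y k\<bar> \<bar>v\<bar>))"
  using y_null riesz_subspace_abs[OF Y] by (simp add: st_up_convergent_in_0_iff)

lemma st_up_convergent_majorizing:
  assumes "majorizing Y"
  shows "st_up_convergent_in p UNIV y 0"
  unfolding st_up_convergent_in_0_iff
proof (intro ballI impI)
  fix u :: 'x
  assume u: "0 \<le> u"
  then obtain v where v: "v \<in> Y" "u \<le> v"
    using assms by (auto simp: majorizing_def)
  have "u \<le> \<bar>v\<bar>"
    using v(2) abs_ge_self by (rule order_trans)
  then show "st_order_null (\<lambda>k. p (inf \<bar>y k\<bar> u))"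
    by (intro st_order_null_mono[OF st_order_null_abs[OF v(1)]] monotone_nonneg inf_mono)
      (use u in simp_all)
qed

lemma st_up_convergent_p_dense:
  assumes "p_dense p Y"
  shows "st_up_convergent_in p UNIV y 0"
  unfolding st_up_convergent_in_0_iff
proof (intro ballI impI)
  fix u :: 'x
  assume u: "0 \<le> u"
  \<comment> \<open>Density only serves nonzero bounds in the range of \<open>p\<close>. By
    homogeneity the bound is the norm of \<open>u\<close> scaled by \<open>1 / real (Suc n)\<close>;
    it is nonzero unless \<open>u = 0\<close>, where 0 itself approximates.\<close>
  have "\<exists>v\<in>Y. p (u - v) \<le> (1 / real (Suc n)) *\<^sub>R p u" for n
  proof (cases "u = 0")
    case True
    have "0 \<in> Y" using Y by (simp add: riesz_subspace_def subspace_0)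
    with True show ?thesis using eq_zero_iff[of 0] by (intro bexI[of _ 0]) simp_all
  next
    case False
    have "p ((1 / real (Suc n)) *\<^sub>R u) = (1 / real (Suc n)) *\<^sub>R p u"
      by (subst homogeneous) simp
    moreover have "p ((1 / real (Suc n)) *\<^sub>R u) \<noteq> 0"
      using False by (simp add: eq_zero_iff)
    ultimately show ?thesis
      using assms unfolding p_dense_def by (metis rangeI)
  qed
  then obtain v where v: "\<And>n. v n \<in> Y" "\<And>n. p (u - v n) \<le> (1 / real (Suc n)) *\<^sub>R p u"
    by metis
  show "st_order_null (\<lambda>k. p (inf \<bar>y k\<bar> u))"
  proof (rule st_order_null_approx[where w = "p u"])
    fix n k
    \<comment> \<open>The first summand is an admissible test element; the second contributes an
      error that does not depend on \<open>k\<close>.\<close>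
    have "u \<le> \<bar>v n\<bar> + \<bar>u - v n\<bar>"
      using abs_triangle_ineq[of "v n" "u - v n"] u by simp
    then have "inf \<bar>y k\<bar> u \<le> inf \<bar>y k\<bar> (\<bar>v n\<bar> + \<bar>u - v n\<bar>)"
      by (intro inf_mono) auto
    also have "\<dots> \<le> inf \<bar>y k\<bar> \<bar>v n\<bar> + inf \<bar>y k\<bar> \<bar>u - v n\<bar>"
      by (intro inf_add_le) simp_all
    also have "\<dots> \<le> inf \<bar>y k\<bar> \<bar>v n\<bar> + \<bar>u - v n\<bar>"
      by (intro add_left_mono) simp
    finally have "p (inf \<bar>y k\<bar> u) \<le> p (inf \<bar>y k\<bar> \<bar>v n\<bar> + \<bar>u - v n\<bar>)"
      using u by (intro monotone_nonneg) simp_all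
    also have "\<dots> \<le> p (inf \<bar>y k\<bar> \<bar>v n\<bar>) + p (u - v n)"
      using triangle[of "inf \<bar>y k\<bar> \<bar>v n\<bar>" "\<bar>u - v n\<bar>"] by (simp add: abs_eq)
    also have "\<dots> \<le> p (inf \<bar>y k\<bar> \<bar>v n\<bar>) + (1 / real (Suc n)) *\<^sub>R p u"
      using v(2) by (intro add_left_mono)
    finally show "p (inf \<bar>y k\<bar> u) \<le> p (inf \<bar>y k\<bar> \<bar>v n\<bar>) + (1 / real (Suc n)) *\<^sub>R p u" .
  qed (use v(1) nonneg st_order_null_abs in auto)
qed

text \<open>The component \<open>c\<close> of \<open>u\<close> is disjoint from every
  \<open>y k\<close> with \<open>1 \<le> k\<close>, so only the component \<open>b\<close> in
  \<open>Y\<close> contributes.\<close>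

lemma st_up_convergent_projection_band:
  assumes "projection_band Y" and y: "\<And>n. 1 \<le> n \<Longrightarrow> y n \<in> Y"
  shows "st_up_convergent_in p UNIV y 0"
  unfolding st_up_convergent_in_0_iff
proof (intro ballI impI)
  fix u :: 'x
  assume u: "0 \<le> u"
  obtain b c where bc: "b \<in> Y" "c \<in> disjoint_complement Y" "u = b + c"
    using assms(1) unfolding projection_band_def by blast
  show "st_order_null (\<lambda>k. p (inf \<bar>y k\<bar> u))"
  proof (rule st_order_null_mono[OF st_order_null_abs[OF bc(1)]])
    fix k :: nat
    assume "1 \<le> k"
    then have disj: "inf \<bar>y k\<bar> \<bar>c\<bar> = 0"
      using bc(2) y[of k] by (auto simp: disjoint_complement_def inf.commute)
    have "u \<le> \<bar>b\<bar> + \<bar>c\<bar>"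
      unfolding bc(3) by (intro add_mono abs_ge_self)
    then have "inf \<bar>y k\<bar> u \<le> inf \<bar>y k\<bar> (\<bar>b\<bar> + \<bar>c\<bar>)"
      by (intro inf_mono) auto
    also have "\<dots> \<le> inf \<bar>y k\<bar> \<bar>b\<bar> + inf \<bar>y k\<bar> \<bar>c\<bar>"
      by (intro inf_add_le) simp_all
    finally have "inf \<bar>y k\<bar> u \<le> inf \<bar>y k\<bar> \<bar>b\<bar>"
      by (simp add: disj)
    then show "p (inf \<bar>y k\<bar> u) \<le> p (inf \<bar>y k\<bar> \<bar>b\<bar>)"
      using u by (intro monotone_nonneg) simp_all
  qed
qed

end

end

theorem theorem4p8:
  fixes p :: "'x::archimedean_riesz_space \<Rightarrow> 'e::archimedean_riesz_space"
    and Y :: "'x set" and y :: "nat \<Rightarrow> 'x"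
  assumes "lattice_normed_riesz_space p"
    and "riesz_subspace Y"
    and "\<And>n. 1 \<le> n \<Longrightarrow> y n \<in> Y"
    and "st_up_convergent_in p Y y 0"
  shows "(majorizing Y \<longrightarrow> st_up_convergent_in p UNIV y 0) \<and>
         (p_dense p Y \<longrightarrow> st_up_convergent_in p UNIV y 0) \<and>
         (projection_band Y \<longrightarrow> st_up_convergent_in p UNIV y 0)"
proof -
  interpret lattice_normed_riesz_space p by (rule assms(1))
  show ?thesis
    using st_up_convergent_majorizing[OF assms(2,4)] st_up_convergent_p_dense[OF assms(2,4)]
      st_up_convergent_projection_band[OF assms(2,4) _ assms(3)]
    by blast
qed

end
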